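(* Let $P$ be a Poisson algebra. Then there is a bijection $$\mathcal{GPH}^2(P,k)\cong(\mathcal{AF}(P)/\equiv_1)\sqcup(\mathcal{NF}(P)/\equiv_2),$$ where: $\equiv_1$ is the equivalence relation on the set $\mathcal{AF}(P)$ of abelian co-flag data of $P$ defined by: $(\lambda,\Lambda,\theta,\gamma,f)\equiv_1(\lambda',\Lambda',\theta',\gamma',f')$ if and only if $\lambda=\lambda'$, $\Lambda=\Lambda'$, $\gamma=\gamma'$ and there exists a linear map $r:P\to k$ such that for all $p,q\in P$: $$\theta(p,q)=\theta'(p,q)+r(q)\lambda'(p)+r(p)\Lambda'(q)-r(pq),$$ $$f(p,q)=f'(p,q)+r(q)\gamma'(p)-r(p)\gamma'(q)-r([p,q]);$$ $\equiv_2$ is the equivalence relation on the set $\mathcal{NF}(P)$ of non-abelian co-flag data of $P$ given by: $(\lambda,\theta,u)\equiv_2(\lambda',\theta',u')$ if and only if $u=u'$ and there exists a linear map $r:P\to k$ such that for all $p,q\in P$: $$\lambda(p)=\lambda'(p)+r(p)u,$$ $$\theta(p,q)=\theta'(p,q)+r(q)\lambda'(p)+r(p)\lambda'(q)-r(pq)+r(p)r(q)u.$$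
   Context: $k$ is an arbitrary field; everything is over $k$. Algebras are associative, not necessarily commutative or unital. A Poisson algebra is a vector space $P$ with an associative multiplication $pq$ and a Lie bracket $[-,-]$ such that $[pq,r]=[p,r]q+p[q,r]$ for all $p,q,r\in P$. A crossed system of $P$ by a vector space $V$ is a system $(\rightharpoonup,\triangleleft,\vartheta,\cdot_V,\triangleright,f,[-,-]_V)$ of bilinear maps $\rightharpoonup:P\times V\to V$, $\triangleleft:V\times P\to V$, $\vartheta:P\times P\to V$, $\cdot_V:V\times V\to V$, $\triangleright:P\times V\to V$, $f:P\times P\to V$, $[-,-]_V:V\times V\to V$ such that $P\times V$ with $(p,x)\star(q,y):=(pq,\ \vartheta(p,q)+p\rightharpoonup y+x\triangleleft q+x\cdot_V y)$ and $\{(p,x),(q,y)\}:=([p,q],\ f(p,q)+p\triangleright y-q\triangleright x+[x,y]_V)$ is a Poisson algebra. Two crossed systems (the second with primes) are cohomologous ($\approx$) if $\cdot_V=\cdot_V'$, $[-,-]_V=[-,-]_V'$ and there is a linear map $r:P\to V$ with, for all $p,q\in P$, $x\in V$: $p\rightharpoonup x=p\rightharpoonup' x+r(p)\cdot_V x$; $x\triangleleft p=x\triangleleft' p+x\cdot_V r(p)$; $\vartheta(p,q)=\vartheta'(p,q)+p\rightharpoonup' r(q)+r(p)\triangleleft' q-r(pq)+r(p)\cdot_V r(q)$; $p\triangleright x=p\triangleright' x+[r(p),x]_V$; $f(p,q)=f'(p,q)+p\triangleright' r(q)-q\triangleright' r(p)+[r(p),r(q)]_V-r([p,q])$. $\mathcal{GPH}^2(P,V)$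 is the set of all crossed systems of $P$ by $V$ modulo $\approx$; here $V=k$ as a one-dimensional vector space. An abelian co-flag datum of $P$ is a 5-tuple $(\lambda,\Lambda,\theta,\gamma,f)$ with $\lambda,\Lambda,\gamma:P\to k$ linear and $\theta,f:P\times P\to k$ bilinear such that for all $p,q,r\in P$: (AF1) $\lambda$ and $\Lambda$ are morphisms of associative algebras; (AF2) $\theta(p,qr)-\theta(pq,r)=\theta(p,q)\Lambda(r)-\theta(q,r)\lambda(p)$; (AF3) $f(p,p)=\gamma([p,q])=0$; (AF4) $f(p,[q,r])+f(q,[r,p])+f(r,[p,q])+\gamma(p)f(q,r)+\gamma(q)f(r,p)+\gamma(r)f(p,q)=0$; (AF5) $f(pq,r)-\Lambda(q)f(p,r)-\lambda(p)f(q,r)=\gamma(r)\theta(p,q)+\theta([p,r],q)+\theta(p,[q,r])$; (AF6) $\gamma(pq)=\gamma(p)\Lambda(q)+\lambda(p)\gamma(q)$; (AF7) $\lambda([p,q])=\Lambda([p,q])=0$. A non-abelian co-flag datum of $P$ is a triple $(\lambda,\theta,u)$ with $u\in k\setminus\{0\}$, $\lambda:P\to k$ linear, $\theta:P\times P\to k$ bilinear such that for all $p,q,r\in P$: (NF1) $\lambda(pq)=\lambda(p)\lambda(q)-u\,\theta(p,q)$; (NF2) $\theta(p,qr)-\theta(pq,r)=\theta(p,q)\lambda(r)-\theta(q,r)\lambda(p)$. *)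

theory Defs
  imports "HOL-Analysis.Product_Vector"
begin

text \<open>
  A vector space over a field \<open>'k\<close> is a type together with a scalar multiplication satisfying the
  library predicate \<open>vector_space\<close>; the field itself, as a one-dimensional vector space, has
  scalar multiplication \<open>(*)\<close>.  Since the field is arbitrary, \<open>linear\<close> is always the
  scale-parametric \<open>Vector_Spaces.linear\<close>, not the real-linear constant.
\<close>

definition bilinear_map ::
    "('k::field \<Rightarrow> 'a::ab_group_add \<Rightarrow> 'a) \<Rightarrow> ('k \<Rightarrow> 'b::ab_group_add \<Rightarrow> 'b) \<Rightarrow>
     ('k \<Rightarrow> 'c::ab_group_add \<Rightarrow> 'c) \<Rightarrow> ('a \<Rightarrow> 'b \<Rightarrow> 'c) \<Rightarrow> bool" where
  "bilinear_map s1 s2 s3 B \<longleftrightarrow>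
     (\<forall>x. Vector_Spaces.linear s2 s3 (\<lambda>y. B x y)) \<and>
     (\<forall>y. Vector_Spaces.linear s1 s3 (\<lambda>x. B x y))"

locale poisson_algebra = vector_space scale
  for scale :: "'k::field \<Rightarrow> 'p::ab_group_add \<Rightarrow> 'p" +
  fixes mult :: "'p \<Rightarrow> 'p \<Rightarrow> 'p"
    and bracket :: "'p \<Rightarrow> 'p \<Rightarrow> 'p"
  assumes bilinear_mult: "bilinear_map scale scale scale mult"
    and mult_assoc: "mult (mult p q) r = mult p (mult q r)"
    and bilinear_bracket: "bilinear_map scale scale scale bracket"
    and bracket_self: "bracket p p = 0"
    and jacobi: "bracket p (bracket q r) + bracket q (bracket r p) + bracket r (bracket p q) = 0"
    and leibniz: "bracket (mult p q) r = mult (bracket p r) q + mult p (bracket q r)"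

subsection \<open>Crossed systems\<close>

text \<open>
  In the order of the fields: \<open>p \<rightharpoonup> x\<close>, \<open>x \<triangleleft> p\<close>, \<open>\<vartheta>(p, q)\<close>,
  \<open>x \<cdot>\<^sub>V y\<close>, \<open>p \<triangleright> x\<close>, \<open>f(p, q)\<close>, \<open>[x, y]\<^sub>V\<close>.
\<close>

record ('p, 'v) crossed_data =
  lact :: "'p \<Rightarrow> 'v \<Rightarrow> 'v"
  ract :: "'v \<Rightarrow> 'p \<Rightarrow> 'v"
  mult_cocycle :: "'p \<Rightarrow> 'p \<Rightarrow> 'v"
  multV :: "'v \<Rightarrow> 'v \<Rightarrow> 'v"
  lie_act :: "'p \<Rightarrow> 'v \<Rightarrow> 'v"
  lie_cocycle :: "'p \<Rightarrow> 'p \<Rightarrow> 'v"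
  bracketV :: "'v \<Rightarrow> 'v \<Rightarrow> 'v"

definition crossed_mult ::
    "('p \<Rightarrow> 'p \<Rightarrow> 'p) \<Rightarrow> ('p, 'v::ab_group_add) crossed_data \<Rightarrow> 'p \<times> 'v \<Rightarrow> 'p \<times> 'v \<Rightarrow> 'p \<times> 'v" where
  "crossed_mult mult S = (\<lambda>(p, x) (q, y).
     (mult p q, mult_cocycle S p q + lact S p y + ract S x q + multV S x y))"

definition crossed_bracket ::
    "('p \<Rightarrow> 'p \<Rightarrow> 'p) \<Rightarrow> ('p, 'v::ab_group_add) crossed_data \<Rightarrow> 'p \<times> 'v \<Rightarrow> 'p \<times> 'v \<Rightarrow> 'p \<times> 'v" where
  "crossed_bracket bracket S = (\<lambda>(p, x) (q, y).
     (bracket p q, lie_cocycle S p q + lie_act S p y - lie_act S q x + bracketV S x y))"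

definition crossed_systems ::
    "('k::field \<Rightarrow> 'p::ab_group_add \<Rightarrow> 'p) \<Rightarrow> ('p \<Rightarrow> 'p \<Rightarrow> 'p) \<Rightarrow> ('p \<Rightarrow> 'p \<Rightarrow> 'p) \<Rightarrow>
     ('k \<Rightarrow> 'v::ab_group_add \<Rightarrow> 'v) \<Rightarrow> ('p, 'v) crossed_data set" where
  "crossed_systems sP mult bracket sV = {S.
     bilinear_map sP sV sV (lact S) \<and>
     bilinear_map sV sP sV (ract S) \<and>
     bilinear_map sP sP sV (mult_cocycle S) \<and>
     bilinear_map sV sV sV (multV S) \<and>
     bilinear_map sP sV sV (lie_act S) \<and>
     bilinear_map sP sP sV (lie_cocycle S) \<and>
     bilinear_map sV sV sV (bracketV S) \<and>
     poisson_algebra (module_prod.scale sP sV) (crossed_mult mult S) (crossed_bracket bracket S)}"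

definition cohomologous ::
    "('k::field \<Rightarrow> 'p::ab_group_add \<Rightarrow> 'p) \<Rightarrow> ('p \<Rightarrow> 'p \<Rightarrow> 'p) \<Rightarrow> ('p \<Rightarrow> 'p \<Rightarrow> 'p) \<Rightarrow>
     ('k \<Rightarrow> 'v::ab_group_add \<Rightarrow> 'v) \<Rightarrow> ('p, 'v) crossed_data rel" where
  "cohomologous sP mult bracket sV = {(S, S').
     S \<in> crossed_systems sP mult bracket sV \<and> S' \<in> crossed_systems sP mult bracket sV \<and>
     multV S = multV S' \<and> bracketV S = bracketV S' \<and>
     (\<exists>r. Vector_Spaces.linear sP sV r \<and>
       (\<forall>p x. lact S p x = lact S' p x + multV S (r p) x) \<and>
       (\<forall>x p. ract S x p = ract S' x p + multV S x (r p)) \<and>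
       (\<forall>p q. mult_cocycle S p q =
          mult_cocycle S' p q + lact S' p (r q) + ract S' (r p) q
            - r (mult p q) + multV S (r p) (r q)) \<and>
       (\<forall>p x. lie_act S p x = lie_act S' p x + bracketV S (r p) x) \<and>
       (\<forall>p q. lie_cocycle S p q =
          lie_cocycle S' p q + lie_act S' p (r q) - lie_act S' q (r p)
            + bracketV S (r p) (r q) - r (bracket p q)))}"

definition GPH2 ::
    "('k::field \<Rightarrow> 'p::ab_group_add \<Rightarrow> 'p) \<Rightarrow> ('p \<Rightarrow> 'p \<Rightarrow> 'p) \<Rightarrow> ('p \<Rightarrow> 'p \<Rightarrow> 'p) \<Rightarrow>
     ('k \<Rightarrow> 'v::ab_group_add \<Rightarrow> 'v) \<Rightarrow> ('p, 'v) crossed_data set set" where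
  "GPH2 sP mult bracket sV =
     crossed_systems sP mult bracket sV // cohomologous sP mult bracket sV"

lemma bilinear_map_minus:
  assumes "bilinear_map s1 s2 s3 B"
  shows "B (- x) y = - B x y" and "B x (- y) = - B x y"
proof -
  have "Vector_Spaces.linear s1 s3 (\<lambda>x. B x y)" "Vector_Spaces.linear s2 s3 (\<lambda>y. B x y)"
    using assms by (auto simp: bilinear_map_def)
  then show "B (- x) y = - B x y" "B x (- y) = - B x y"
    by (auto simp: linear_iff_module_hom dest: module_hom.neg)
qed

lemma bilinear_map_add:
  assumes "bilinear_map s1 s2 s3 B"
  shows "B (x + x') y = B x y + B x' y" and "B x (y + y') = B x y + B x y'"
proof -
  have "Vector_Spaces.linear s1 s3 (\<lambda>x. B x y)" "Vector_Spaces.linear s2 s3 (\<lambda>y. B x y)"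
    using assms by (auto simp: bilinear_map_def)
  then show "B (x + x') y = B x y + B x' y" "B x (y + y') = B x y + B x y'"
    by (auto simp: Vector_Spaces.linear_iff)
qed

lemma bilinear_map_zero:
  assumes "bilinear_map s1 s2 s3 B"
  shows "B 0 y = 0" and "B x 0 = 0"
  using bilinear_map_add(1)[OF assms, of 0 0 y] bilinear_map_add(2)[OF assms, of x 0 0] by simp_all

lemma crossed_bracket_anti:
  assumes "S \<in> crossed_systems sP mult bracket sV"
  shows "bracketV S x y = - bracketV S y x"
proof -
  have bil: "bilinear_map sP sV sV (lie_act S)" "bilinear_map sP sP sV (lie_cocycle S)"
    "bilinear_map sV sV sV (bracketV S)"
    using assms by (auto simp: crossed_systems_def)
  interpret Q: poisson_algebra "module_prod.scale sP sV" "crossed_mult mult S"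
    "crossed_bracket bracket S"
    using assms by (simp add: crossed_systems_def)
  have self: "bracketV S z z = 0" for z
    using Q.bracket_self[of "(0, z)"]
    by (simp add: crossed_bracket_def zero_prod_def bilinear_map_zero[OF bil(2)])
  show ?thesis
    using self[of "x + y"] self[of x] self[of y]
    unfolding bilinear_map_add[OF bil(3)] by (simp add: eq_neg_iff_add_eq_0 add.commute[of "bracketV S y x"])
qed

lemma equiv_cohomologous:
  assumes "vector_space sP" and "vector_space sV"
  shows "equiv (crossed_systems sP mult bracket sV) (cohomologous sP mult bracket sV)"
proof (rule equivI)
  let ?C = "crossed_systems sP mult bracket sV" and ?R = "cohomologous sP mult bracket sV"
  note lin = Vector_Spaces.linear_iff assms
  interpret V: vector_space sV by fact
  have bil: "bilinear_map sP sV sV (lact S)" "bilinear_map sV sP sV (ract S)"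
    "bilinear_map sV sV sV (multV S)" "bilinear_map sP sV sV (lie_act S)"
    "bilinear_map sV sV sV (bracketV S)" if "S \<in> ?C" for S
    using that by (auto simp: crossed_systems_def)
  show "?R \<subseteq> ?C \<times> ?C"
    by (auto simp: cohomologous_def)
  show "refl_on ?C ?R"
  proof (rule refl_onI)
    fix S assume S: "S \<in> ?C"
    show "(S, S) \<in> ?R"
      unfolding cohomologous_def
      using S by (auto intro!: exI[of _ "\<lambda>_. 0"]
        simp: lin V.scale_zero_right bilinear_map_zero[OF bil(1)[OF S]] bilinear_map_zero[OF bil(2)[OF S]]
        bilinear_map_zero[OF bil(3)[OF S]] bilinear_map_zero[OF bil(4)[OF S]]
        bilinear_map_zero[OF bil(5)[OF S]])
  qed
  show "sym ?R"
  proof (rule symI)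
    fix S S' assume "(S, S') \<in> ?R"
    then obtain r where C: "S \<in> ?C" "S' \<in> ?C"
      and eq: "multV S = multV S'" "bracketV S = bracketV S'"
      and r: "Vector_Spaces.linear sP sV r"
       "\<And>p x. lact S p x = lact S' p x + multV S (r p) x"
       "\<And>x p. ract S x p = ract S' x p + multV S x (r p)"
       "\<And>p q. mult_cocycle S p q =
          mult_cocycle S' p q + lact S' p (r q) + ract S' (r p) q
            - r (mult p q) + multV S (r p) (r q)"
       "\<And>p x. lie_act S p x = lie_act S' p x + bracketV S (r p) x"
       "\<And>p q. lie_cocycle S p q =
          lie_cocycle S' p q + lie_act S' p (r q) - lie_act S' q (r p)
            + bracketV S (r p) (r q) - r (bracket p q)"
      unfolding cohomologous_def by auto
    have "Vector_Spaces.linear sP sV (\<lambda>p. - r p)"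
      using r(1) by (simp add: Vector_Spaces.linear_iff)
    moreover have "- bracketV S' (r q) (r p) = bracketV S' (r p) (r q)" for p q
      by (rule crossed_bracket_anti[OF C(2), symmetric])
    moreover from this have "bracketV S' (r p) (r q) + bracketV S' (r q) (r p) = 0" for p q
      by (metis add.left_inverse add.commute)
    ultimately show "(S', S) \<in> ?R"
      unfolding cohomologous_def
      using C by (auto intro!: exI[of _ "\<lambda>p. - r p"] simp: r(2-) eq algebra_simps
        bilinear_map_minus[OF bil(1)[OF C(2)]] bilinear_map_minus[OF bil(2)[OF C(2)]]
        bilinear_map_minus[OF bil(3)[OF C(2)]] bilinear_map_minus[OF bil(4)[OF C(2)]]
        bilinear_map_minus[OF bil(5)[OF C(2)]])
  qed
  show "trans ?R"
  proof (rule transI)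
    fix S S' S'' assume "(S, S') \<in> ?R" "(S', S'') \<in> ?R"
    then obtain r r' where C: "S \<in> ?C" "S' \<in> ?C" "S'' \<in> ?C"
      and eq: "multV S = multV S''" "bracketV S = bracketV S''"
        "multV S' = multV S''" "bracketV S' = bracketV S''"
      and r: "Vector_Spaces.linear sP sV r"
       "\<And>p x. lact S p x = lact S' p x + multV S (r p) x"
       "\<And>x p. ract S x p = ract S' x p + multV S x (r p)"
       "\<And>p q. mult_cocycle S p q =
          mult_cocycle S' p q + lact S' p (r q) + ract S' (r p) q
            - r (mult p q) + multV S (r p) (r q)"
       "\<And>p x. lie_act S p x = lie_act S' p x + bracketV S (r p) x"
       "\<And>p q. lie_cocycle S p q =
          lie_cocycle S' p q + lie_act S' p (r q) - lie_act S' q (r p)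
            + bracketV S (r p) (r q) - r (bracket p q)"
      and r': "Vector_Spaces.linear sP sV r'"
       "\<And>p x. lact S' p x = lact S'' p x + multV S' (r' p) x"
       "\<And>x p. ract S' x p = ract S'' x p + multV S' x (r' p)"
       "\<And>p q. mult_cocycle S' p q =
          mult_cocycle S'' p q + lact S'' p (r' q) + ract S'' (r' p) q
            - r' (mult p q) + multV S' (r' p) (r' q)"
       "\<And>p x. lie_act S' p x = lie_act S'' p x + bracketV S' (r' p) x"
       "\<And>p q. lie_cocycle S' p q =
          lie_cocycle S'' p q + lie_act S'' p (r' q) - lie_act S'' q (r' p)
            + bracketV S' (r' p) (r' q) - r' (bracket p q)"
      unfolding cohomologous_def by auto
    have "Vector_Spaces.linear sP sV (\<lambda>p. r p + r' p)"
      using r(1) r'(1) by (simp add: Vector_Spaces.linear_iff algebra_simps V.scale_right_distrib)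
    moreover have "bracketV S'' (r p) (r' q) = - bracketV S'' (r' q) (r p)" for p q
      by (rule crossed_bracket_anti[OF C(3)])
    ultimately show "(S, S'') \<in> ?R"
      unfolding cohomologous_def
      using C by (auto intro!: exI[of _ "\<lambda>p. r p + r' p"] simp: r(2-) r'(2-) eq algebra_simps
        bilinear_map_add[OF bil(1)[OF C(3)]] bilinear_map_add[OF bil(2)[OF C(3)]]
        bilinear_map_add[OF bil(3)[OF C(3)]] bilinear_map_add[OF bil(4)[OF C(3)]]
        bilinear_map_add[OF bil(5)[OF C(3)]])
  qed
qed

subsection \<open>Co-flag data\<close>

record ('p, 'k) abelian_data =
  af_lambda :: "'p \<Rightarrow> 'k"
  af_Lambda :: "'p \<Rightarrow> 'k"
  af_theta :: "'p \<Rightarrow> 'p \<Rightarrow> 'k"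
  af_gamma :: "'p \<Rightarrow> 'k"
  af_f :: "'p \<Rightarrow> 'p \<Rightarrow> 'k"

record ('p, 'k) nonabelian_data =
  nf_lambda :: "'p \<Rightarrow> 'k"
  nf_theta :: "'p \<Rightarrow> 'p \<Rightarrow> 'k"
  nf_u :: "'k"

definition abelian_co_flag_datum ::
    "('k::field \<Rightarrow> 'p::ab_group_add \<Rightarrow> 'p) \<Rightarrow> ('p \<Rightarrow> 'p \<Rightarrow> 'p) \<Rightarrow> ('p \<Rightarrow> 'p \<Rightarrow> 'p) \<Rightarrow>
     ('p \<Rightarrow> 'k) \<Rightarrow> ('p \<Rightarrow> 'k) \<Rightarrow> ('p \<Rightarrow> 'p \<Rightarrow> 'k) \<Rightarrow> ('p \<Rightarrow> 'k) \<Rightarrow> ('p \<Rightarrow> 'p \<Rightarrow> 'k) \<Rightarrow> bool" where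
  "abelian_co_flag_datum sP mult bracket lam \<Lambda> \<theta> \<gamma> f \<longleftrightarrow>
     Vector_Spaces.linear sP (*) lam \<and>
     Vector_Spaces.linear sP (*) \<Lambda> \<and>
     Vector_Spaces.linear sP (*) \<gamma> \<and>
     bilinear_map sP sP (*) \<theta> \<and>
     bilinear_map sP sP (*) f \<and>
     (\<forall>p q. lam (mult p q) = lam p * lam q \<and> \<Lambda> (mult p q) = \<Lambda> p * \<Lambda> q) \<and>
     (\<forall>p q r. \<theta> p (mult q r) - \<theta> (mult p q) r = \<theta> p q * \<Lambda> r - \<theta> q r * lam p) \<and>
     (\<forall>p q. f p p = 0 \<and> \<gamma> (bracket p q) = 0) \<and>
     (\<forall>p q r. f p (bracket q r) + f q (bracket r p) + f r (bracket p q)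
        + \<gamma> p * f q r + \<gamma> q * f r p + \<gamma> r * f p q = 0) \<and>
     (\<forall>p q r. f (mult p q) r - \<Lambda> q * f p r - lam p * f q r =
        \<gamma> r * \<theta> p q + \<theta> (bracket p r) q + \<theta> p (bracket q r)) \<and>
     (\<forall>p q. \<gamma> (mult p q) = \<gamma> p * \<Lambda> q + lam p * \<gamma> q) \<and>
     (\<forall>p q. lam (bracket p q) = 0 \<and> \<Lambda> (bracket p q) = 0)"

definition AF ::
    "('k::field \<Rightarrow> 'p::ab_group_add \<Rightarrow> 'p) \<Rightarrow> ('p \<Rightarrow> 'p \<Rightarrow> 'p) \<Rightarrow> ('p \<Rightarrow> 'p \<Rightarrow> 'p) \<Rightarrow>
     ('p, 'k) abelian_data set" where
  "AF sP mult bracket = {D. abelian_co_flag_datum sP mult bracket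
     (af_lambda D) (af_Lambda D) (af_theta D) (af_gamma D) (af_f D)}"

definition nonabelian_co_flag_datum ::
    "('k::field \<Rightarrow> 'p::ab_group_add \<Rightarrow> 'p) \<Rightarrow> ('p \<Rightarrow> 'p \<Rightarrow> 'p) \<Rightarrow>
     ('p \<Rightarrow> 'k) \<Rightarrow> ('p \<Rightarrow> 'p \<Rightarrow> 'k) \<Rightarrow> 'k \<Rightarrow> bool" where
  "nonabelian_co_flag_datum sP mult lam \<theta> u \<longleftrightarrow>
     u \<noteq> 0 \<and>
     Vector_Spaces.linear sP (*) lam \<and>
     bilinear_map sP sP (*) \<theta> \<and>
     (\<forall>p q. lam (mult p q) = lam p * lam q - u * \<theta> p q) \<and>
     (\<forall>p q r. \<theta> p (mult q r) - \<theta> (mult p q) r = \<theta> p q * lam r - \<theta> q r * lam p)"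

text \<open>The bracket of the Poisson algebra does not enter the non-abelian axioms.\<close>

definition NF ::
    "('k::field \<Rightarrow> 'p::ab_group_add \<Rightarrow> 'p) \<Rightarrow> ('p \<Rightarrow> 'p \<Rightarrow> 'p) \<Rightarrow> ('p, 'k) nonabelian_data set" where
  "NF sP mult = {D. nonabelian_co_flag_datum sP mult (nf_lambda D) (nf_theta D) (nf_u D)}"

definition AF_rel ::
    "('k::field \<Rightarrow> 'p::ab_group_add \<Rightarrow> 'p) \<Rightarrow> ('p \<Rightarrow> 'p \<Rightarrow> 'p) \<Rightarrow> ('p \<Rightarrow> 'p \<Rightarrow> 'p) \<Rightarrow>
     ('p, 'k) abelian_data rel" where
  "AF_rel sP mult bracket = {(D, D').
     D \<in> AF sP mult bracket \<and> D' \<in> AF sP mult bracket \<and>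
     af_lambda D = af_lambda D' \<and> af_Lambda D = af_Lambda D' \<and> af_gamma D = af_gamma D' \<and>
     (\<exists>r. Vector_Spaces.linear sP (*) r \<and>
       (\<forall>p q. af_theta D p q =
          af_theta D' p q + r q * af_lambda D' p + r p * af_Lambda D' q - r (mult p q)) \<and>
       (\<forall>p q. af_f D p q =
          af_f D' p q + r q * af_gamma D' p - r p * af_gamma D' q - r (bracket p q)))}"

definition NF_rel ::
    "('k::field \<Rightarrow> 'p::ab_group_add \<Rightarrow> 'p) \<Rightarrow> ('p \<Rightarrow> 'p \<Rightarrow> 'p) \<Rightarrow> ('p, 'k) nonabelian_data rel" where
  "NF_rel sP mult = {(D, D').
     D \<in> NF sP mult \<and> D' \<in> NF sP mult \<and>
     nf_u D = nf_u D' \<and>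
     (\<exists>r. Vector_Spaces.linear sP (*) r \<and>
       (\<forall>p. nf_lambda D p = nf_lambda D' p + r p * nf_u D) \<and>
       (\<forall>p q. nf_theta D p q =
          nf_theta D' p q + r q * nf_lambda D' p + r p * nf_lambda D' q
            - r (mult p q) + r p * r q * nf_u D))}"

end

theory Submission
  imports Defs
begin

text \<open>
  On a one-dimensional space every bilinear map is multiplication by scalars.  Hence a crossed
  system of \<open>P\<close> by \<open>k\<close> is nothing but three functionals \<open>\<lambda>, \<Lambda>, \<gamma>\<close> on \<open>P\<close> (the actions), two
  bilinear forms \<open>\<theta>, f\<close> on \<open>P\<close> (the cocycles) and one scalar \<open>u\<close> with \<open>x \<cdot> y = u x y\<close>; the bracket on
  \<open>k\<close> is alternating and so vanishes.  Evaluating the Poisson identities on the elements \<open>(p, 0)\<close>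
  and \<open>(0, 1)\<close> gives a complete list of equations for \<open>(\<lambda>, \<Lambda>, \<theta>, u, \<gamma>, f)\<close>
  (lemma \<open>scalar_system_crossed_iff\<close>), among them
  \<open>u \<Lambda> = u \<lambda>\<close>, \<open>u \<gamma> = 0\<close> and \<open>\<lambda>[p, q] = \<Lambda>[p, q] = - u f(p, q)\<close>.

  These force a dichotomy.  If \<open>u = 0\<close>, they say that \<open>\<lambda>\<close> and \<open>\<Lambda>\<close> vanish on brackets, and what
  remains is exactly an abelian co-flag datum.  If \<open>u \<noteq> 0\<close>, they determine \<open>\<Lambda> = \<lambda>\<close>, \<open>\<gamma> = 0\<close> and
  \<open>f(p, q) = - \<lambda>[p, q] / u\<close>, and the remaining Lie-theoretic equations then follow from those of
  \<open>P\<close>: the Jacobi identity for \<open>f\<close> is \<open>\<lambda>\<close> applied to the Jacobi identity of \<open>P\<close>, and the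
  compatibility of \<open>f\<close> with the product is \<open>\<lambda>\<close> applied to the Leibniz rule.  So the datum reduces to
  the non-abelian co-flag datum \<open>(\<lambda>, \<theta>, u)\<close>.

  The scalar \<open>u\<close> is a cohomology invariant, so the two families are never cohomologous to each
  other; within each family cohomology is exactly the relation \<open>\<equiv>\<^sub>1\<close> or \<open>\<equiv>\<^sub>2\<close>.  Therefore both
  relations inherit being equivalences from cohomology, and the quotient of the crossed systems
  is the disjoint sum of the two quotients.
\<close>

section \<open>Quotients of a set covered by two parametrisations\<close>

lemma equiv_pullback:
  assumes "equiv C R" and "g ` A \<subseteq> C" and Q: "Q \<subseteq> A \<times> A"
    and R: "\<And>a a'. a \<in> A \<Longrightarrow> a' \<in> A \<Longrightarrow> (g a, g a') \<in> R \<longleftrightarrow> (a, a') \<in> Q"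
  shows "equiv A Q"
proof (rule equivI)
  show "Q \<subseteq> A \<times> A" by fact
  show "refl_on A Q"
  proof (rule refl_onI)
    fix a assume a: "a \<in> A"
    then have "(g a, g a) \<in> R"
      using assms(1,2) by (auto elim!: equivE intro: refl_onD)
    with a show "(a, a) \<in> Q" using assms(4) by blast
  qed
  show "sym Q"
  proof (rule symI)
    fix a b assume ab: "(a, b) \<in> Q"
    with Q have "a \<in> A" "b \<in> A" by auto
    with ab R show "(b, a) \<in> Q" by (metis equivE assms(1) symD)
  qed
  show "trans Q"
  proof (rule transI)
    fix a b c assume ab: "(a, b) \<in> Q" "(b, c) \<in> Q"
    with Q have "a \<in> A" "b \<in> A" "c \<in> A" by auto
    with ab R show "(a, c) \<in> Q" by (metis equivE assms(1) transD)
  qed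
qed

text \<open>
  Each of \<open>g\<close> and \<open>h\<close> descends to quotients because it preserves the relation, and the descended map
  is injective because it reflects the relation.  The images of the two quotients are disjoint by
  \<open>gh\<close> and exhaust \<open>C // R\<close> by \<open>cover\<close>.
\<close>
lemma bij_betw_quotient_sum:
  assumes R: "equiv C R" and cover: "g ` A \<union> h ` B = C"
    and QA: "equiv A QA" and QB: "equiv B QB"
    and g: "\<And>a a'. a \<in> A \<Longrightarrow> a' \<in> A \<Longrightarrow> (g a, g a') \<in> R \<longleftrightarrow> (a, a') \<in> QA"
    and h: "\<And>b b'. b \<in> B \<Longrightarrow> b' \<in> B \<Longrightarrow> (h b, h b') \<in> R \<longleftrightarrow> (b, b') \<in> QB"
    and gh: "\<And>a b. a \<in> A \<Longrightarrow> b \<in> B \<Longrightarrow> (g a, h b) \<notin> R"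
  shows "\<exists>\<Phi>. bij_betw \<Phi> (C // R) ((A // QA) <+> (B // QB))"
proof -
  define \<Psi> where "\<Psi> = case_sum (\<lambda>X. R `` (g ` X)) (\<lambda>Y. R `` (h ` Y))"
  have sub: "g ` A \<subseteq> C" "h ` B \<subseteq> C" using cover by auto
  \<comment> \<open>\<open>g\<close> may miss part of the class of \<open>g a\<close>; applying \<open>R\<close> once more fills it up.\<close>
  have cls_g: "R `` (g ` (QA `` {a})) = R `` {g a}" if "a \<in> A" for a
  proof -
    have "g ` (QA `` {a}) \<subseteq> R `` {g a}"
      using that g QA by (auto dest: equiv_type)
    moreover have "g a \<in> g ` (QA `` {a})"
      using that by (intro imageI equiv_class_self[OF QA])
    moreover have "R `` (R `` {g a}) \<subseteq> R `` {g a}"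
      using R by (auto elim!: equivE dest: transD)
    ultimately show ?thesis by blast
  qed
  have cls_h: "R `` (h ` (QB `` {b})) = R `` {h b}" if "b \<in> B" for b
  proof -
    have "h ` (QB `` {b}) \<subseteq> R `` {h b}"
      using that h QB by (auto dest: equiv_type)
    moreover have "h b \<in> h ` (QB `` {b})"
      using that by (intro imageI equiv_class_self[OF QB])
    moreover have "R `` (R `` {h b}) \<subseteq> R `` {h b}"
      using R by (auto elim!: equivE dest: transD)
    ultimately show ?thesis by blast
  qed
  have eqR: "R `` {c} = R `` {c'} \<longleftrightarrow> (c, c') \<in> R" if "c \<in> C" "c' \<in> C" for c c'
    using eq_equiv_class_iff[OF R that] .
  have "bij_betw \<Psi> ((A // QA) <+> (B // QB)) (C // R)"
    unfolding bij_betw_def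
  proof
    have gA: "g a \<in> C" if "a \<in> A" for a using that sub by auto
    have hB: "h b \<in> C" if "b \<in> B" for b using that sub by auto
    have hg: "(h b, g a) \<notin> R" if "a \<in> A" "b \<in> B" for a b
      using gh[OF that] R by (auto elim!: equivE dest: symD)
    show "inj_on \<Psi> ((A // QA) <+> (B // QB))"
      by (rule inj_onI)
        (auto simp: \<Psi>_def cls_g cls_h eqR gA hB g h gh hg
          eq_equiv_class_iff[OF QA] eq_equiv_class_iff[OF QB] elim!: quotientE PlusE del: equalityI)
    show "\<Psi> ` ((A // QA) <+> (B // QB)) = C // R"
    proof
      show "\<Psi> ` ((A // QA) <+> (B // QB)) \<subseteq> C // R"
        by (auto simp: \<Psi>_def cls_g cls_h elim!: quotientE intro!: quotientI gA hB)
      show "C // R \<subseteq> \<Psi> ` ((A // QA) <+> (B // QB))"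
      proof
        fix Z assume "Z \<in> C // R"
        then obtain c where c: "c \<in> C" "Z = R `` {c}" by (auto elim: quotientE)
        with cover consider a where "a \<in> A" "c = g a" | b where "b \<in> B" "c = h b" by auto
        then show "Z \<in> \<Psi> ` ((A // QA) <+> (B // QB))"
        proof cases
          case 1
          then have "Z = \<Psi> (Inl (QA `` {a}))" by (simp add: \<Psi>_def cls_g c)
          then show ?thesis using 1 by (auto intro: quotientI)
        next
          case 2
          then have "Z = \<Psi> (Inr (QB `` {b}))" by (simp add: \<Psi>_def cls_h c)
          then show ?thesis using 2 by (auto intro: quotientI)
        qed
      qed
    qed
  qed
  then show ?thesis by (blast intro: bij_betw_inv_into)
qed

section \<open>Crossed systems by a one-dimensional space\<close>

lemma bilinear_map_iff:
  "bilinear_map s1 s2 s3 B \<longleftrightarrow>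
     vector_space s1 \<and> vector_space s2 \<and> vector_space s3 \<and>
     (\<forall>x x' y. B (x + x') y = B x y + B x' y) \<and> (\<forall>x y y'. B x (y + y') = B x y + B x y') \<and>
     (\<forall>c x y. B (s1 c x) y = s3 c (B x y)) \<and> (\<forall>c x y. B x (s2 c y) = s3 c (B x y))"
  unfolding bilinear_map_def Vector_Spaces.linear_iff by blast

lemma vector_space_times: "vector_space ((*) :: 'k::field \<Rightarrow> 'k \<Rightarrow> 'k)"
  by unfold_locales (simp_all add: algebra_simps)

definition scalar_system ::
    "('p \<Rightarrow> 'k::field) \<Rightarrow> ('p \<Rightarrow> 'k) \<Rightarrow> ('p \<Rightarrow> 'p \<Rightarrow> 'k) \<Rightarrow> 'k \<Rightarrow> ('p \<Rightarrow> 'k) \<Rightarrow> ('p \<Rightarrow> 'p \<Rightarrow> 'k) \<Rightarrow>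
     ('p, 'k) crossed_data" where
  "scalar_system lam \<Lambda> \<theta> u \<gamma> f =
     \<lparr>lact = \<lambda>p x. lam p * x, ract = \<lambda>x p. \<Lambda> p * x, mult_cocycle = \<theta>,
      multV = \<lambda>x y. u * x * y, lie_act = \<lambda>p x. \<gamma> p * x, lie_cocycle = f, bracketV = \<lambda>_ _. 0\<rparr>"

context poisson_algebra
begin

lemma vector_space_prod_times: "vector_space (module_prod.scale scale ((*) :: 'k \<Rightarrow> 'k \<Rightarrow> 'k))"
  and prod_times_scale: "module_prod.scale scale (*) c (p, x) = (scale c p, c * x :: 'k)"
proof -
  interpret PP: vector_space_prod scale "(*) :: 'k \<Rightarrow> 'k \<Rightarrow> 'k"
    by (simp add: vector_space_prod_def vector_space_pair_def vector_space_axioms vector_space_times)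
  show "vector_space (module_prod.scale scale ((*) :: 'k \<Rightarrow> 'k \<Rightarrow> 'k))"
    by (rule PP.p.vector_space_axioms)
  show "module_prod.scale scale (*) c (p, x) = (scale c p, c * x :: 'k)"
    by (rule PP.scale_prod)
qed

lemma bilinear_scalar_iff:
  fixes l :: "'p \<Rightarrow> 'k"
  shows "bilinear_map scale (*) (*) (\<lambda>p x. l p * x) \<longleftrightarrow> Vector_Spaces.linear scale (*) l"
    and "bilinear_map (*) scale (*) (\<lambda>x p. l p * x) \<longleftrightarrow> Vector_Spaces.linear scale (*) l"
  unfolding bilinear_map_iff Vector_Spaces.linear_iff
  by (auto simp: algebra_simps vector_space_times vector_space_axioms)
     (metis mult_1_right mult.commute mult.left_commute)+

text \<open>
  Each structure map is linear in its argument from \<open>k\<close>, so it is fixed by its value at \<open>1\<close>.  The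
  bracket on \<open>k\<close> is fixed by \<open>[1, 1] = 0\<close>; this uses that the bracket is alternating, as
  antisymmetry would not suffice in characteristic two.
\<close>
lemma crossed_system_is_scalar:
  fixes S :: "('p, 'k) crossed_data"
  assumes "S \<in> crossed_systems scale mult bracket (*)"
  shows "S = scalar_system (\<lambda>p. lact S p 1) (\<lambda>p. ract S 1 p) (mult_cocycle S) (multV S 1 1)
    (\<lambda>p. lie_act S p 1) (lie_cocycle S)"
proof -
  have bil: "bilinear_map scale (*) (*) (lact S)" "bilinear_map (*) scale (*) (ract S)"
    "bilinear_map (*) (*) (*) (multV S)" "bilinear_map scale (*) (*) (lie_act S)"
    "bilinear_map (*) (*) (*) (bracketV S)" "bilinear_map scale scale (*) (lie_cocycle S)"
    using assms by (auto simp: crossed_systems_def)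
  interpret Q: poisson_algebra "module_prod.scale scale (*)" "crossed_mult mult S"
    "crossed_bracket bracket S"
    using assms by (simp add: crossed_systems_def)
  have "bracketV S 1 1 = 0"
    using Q.bracket_self[of "(0, 1)"]
    by (simp add: crossed_bracket_def zero_prod_def bilinear_map_zero[OF bil(6)])
  moreover have "bracketV S x y = x * y * bracketV S 1 1"
    "multV S x y = x * y * multV S 1 1" for x y
    using bil(3,5) unfolding bilinear_map_iff by (metis mult_1_right mult.assoc)+
  moreover have "lact S p x = x * lact S p 1" "ract S x p = x * ract S 1 p"
    "lie_act S p x = x * lie_act S p 1" for p x
    using bil(1,2,4) unfolding bilinear_map_iff by (metis mult_1_right)+
  ultimately have "lact S = (\<lambda>p x. lact S p 1 * x)" "ract S = (\<lambda>x p. ract S 1 p * x)"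
    "lie_act S = (\<lambda>p x. lie_act S p 1 * x)" "multV S = (\<lambda>x y. multV S 1 1 * x * y)"
    "bracketV S = (\<lambda>_ _. 0)"
    by (metis mult.commute mult.assoc mult_zero_right)+
  then show ?thesis
    unfolding scalar_system_def by (intro crossed_data.equality) auto
qed

text \<open>
  Both sides of every Poisson identity on \<open>P \<times> k\<close> are polynomial in the \<open>k\<close>-components \<open>x, y, z\<close> of the
  three arguments, and each listed equation compares the coefficients of one monomial: the cocycle
  equations are the constant terms, the equations on \<open>\<lambda>, \<Lambda>, \<gamma>\<close> are the linear terms, and
  \<open>u \<Lambda> = u \<lambda>\<close> and \<open>u \<gamma> = 0\<close> come from \<open>xz\<close> in associativity and \<open>yz\<close> in the Leibniz rule.
\<close>
lemma scalar_system_crossed_iff: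
  fixes lam \<Lambda> \<gamma> :: "'p \<Rightarrow> 'k" and \<theta> f :: "'p \<Rightarrow> 'p \<Rightarrow> 'k" and u :: 'k
  shows "scalar_system lam \<Lambda> \<theta> u \<gamma> f \<in> crossed_systems scale mult bracket (*) \<longleftrightarrow>
    Vector_Spaces.linear scale (*) lam \<and> Vector_Spaces.linear scale (*) \<Lambda> \<and>
    Vector_Spaces.linear scale (*) \<gamma> \<and>
    bilinear_map scale scale (*) \<theta> \<and> bilinear_map scale scale (*) f \<and>
    (\<forall>p q. lam (mult p q) = lam p * lam q - u * \<theta> p q) \<and>
    (\<forall>p q. \<Lambda> (mult p q) = \<Lambda> p * \<Lambda> q - u * \<theta> p q) \<and>
    (\<forall>p. u * \<Lambda> p = u * lam p) \<and>
    (\<forall>p q r. \<theta> p (mult q r) - \<theta> (mult p q) r = \<theta> p q * \<Lambda> r - \<theta> q r * lam p) \<and>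
    (\<forall>p. f p p = 0) \<and> (\<forall>p q. \<gamma> (bracket p q) = 0) \<and>
    (\<forall>p q r. f p (bracket q r) + f q (bracket r p) + f r (bracket p q)
        + \<gamma> p * f q r + \<gamma> q * f r p + \<gamma> r * f p q = 0) \<and>
    (\<forall>p q r. f (mult p q) r - \<Lambda> q * f p r - lam p * f q r =
        \<gamma> r * \<theta> p q + \<theta> (bracket p r) q + \<theta> p (bracket q r)) \<and>
    (\<forall>p q. \<gamma> (mult p q) = \<gamma> p * \<Lambda> q + lam p * \<gamma> q) \<and>
    (\<forall>p. u * \<gamma> p = 0) \<and>
    (\<forall>p q. lam (bracket p q) = - u * f p q) \<and>
    (\<forall>p q. \<Lambda> (bracket p q) = - u * f p q)"
    (is "?S \<in> _ \<longleftrightarrow> ?R")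
proof
  assume S: "?S \<in> crossed_systems scale mult bracket (*)"
  note sel = scalar_system_def crossed_data.simps
  note zero = bilinear_map_zero[OF bilinear_mult] bilinear_map_zero[OF bilinear_bracket]
  have lin: "Vector_Spaces.linear scale (*) lam" "Vector_Spaces.linear scale (*) \<Lambda>"
    "Vector_Spaces.linear scale (*) \<gamma>"
    "bilinear_map scale scale (*) \<theta>" "bilinear_map scale scale (*) f"
    using S by (auto simp: crossed_systems_def sel bilinear_scalar_iff)
  have lin0: "lam 0 = 0" "\<Lambda> 0 = 0" "\<gamma> 0 = 0"
    using lin(1-3) by (auto simp: linear_iff_module_hom dest: module_hom.zero)
  note zs = zero lin0 bilinear_map_zero[OF lin(4)] bilinear_map_zero[OF lin(5)]
  interpret Q: poisson_algebra "module_prod.scale scale (*)" "crossed_mult mult ?S"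
    "crossed_bracket bracket ?S"
    using S by (simp add: crossed_systems_def)
  note A = Q.mult_assoc[unfolded crossed_mult_def sel]
  note J = Q.jacobi[unfolded crossed_bracket_def sel zero_prod_def]
  note L = Q.leibniz[unfolded crossed_mult_def crossed_bracket_def sel]
  show ?R
  proof (intro conjI allI)
    fix p q r
    show "lam (mult p q) = lam p * lam q - u * \<theta> p q"
      using A[of "(p, 0)" "(q, 0)" "(0, 1)"] by (simp add: zs algebra_simps)
    show "\<Lambda> (mult p q) = \<Lambda> p * \<Lambda> q - u * \<theta> p q"
      using A[of "(0, 1)" "(p, 0)" "(q, 0)"] by (simp add: zs algebra_simps)
    show "u * \<Lambda> p = u * lam p"
      using A[of "(0, 1)" "(p, 0)" "(0, 1)"] by (simp add: zs algebra_simps)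
    show "\<theta> p (mult q r) - \<theta> (mult p q) r = \<theta> p q * \<Lambda> r - \<theta> q r * lam p"
      using A[of "(p, 0)" "(q, 0)" "(r, 0)"] by (simp add: zs algebra_simps)
    show "f p p = 0"
      using Q.bracket_self[of "(p, 0)"] by (simp add: crossed_bracket_def sel zero_prod_def)
    show "\<gamma> (bracket p q) = 0"
      using J[of "(p, 0)" "(q, 0)" "(0, 1)"] by (simp add: zs algebra_simps)
    show "f p (bracket q r) + f q (bracket r p) + f r (bracket p q)
      + \<gamma> p * f q r + \<gamma> q * f r p + \<gamma> r * f p q = 0"
      using J[of "(p, 0)" "(q, 0)" "(r, 0)"] by (simp add: zs algebra_simps)
    show "f (mult p q) r - \<Lambda> q * f p r - lam p * f q r =
      \<gamma> r * \<theta> p q + \<theta> (bracket p r) q + \<theta> p (bracket q r)"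
      using L[of "(p, 0)" "(q, 0)" "(r, 0)"] by (simp add: zs algebra_simps)
    show "\<gamma> (mult p q) = \<gamma> p * \<Lambda> q + lam p * \<gamma> q"
      using L[of "(p, 0)" "(q, 0)" "(0, 1)"] by (simp add: zs algebra_simps)
    show "u * \<gamma> p = 0"
      using L[of "(p, 0)" "(0, 1)" "(0, 1)"] by (simp add: zs algebra_simps)
    show "lam (bracket p q) = - u * f p q"
      using L[of "(p, 0)" "(0, 1)" "(q, 0)"] by (simp add: zs algebra_simps eq_neg_iff_add_eq_0)
    show "\<Lambda> (bracket p q) = - u * f p q"
      using L[of "(0, 1)" "(p, 0)" "(q, 0)"] by (simp add: zs algebra_simps eq_neg_iff_add_eq_0)
  qed (use lin in auto)
next
  assume R: ?R
  note sel = scalar_system_def crossed_data.simps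
  note bil = bilinear_mult[unfolded bilinear_map_iff] bilinear_bracket[unfolded bilinear_map_iff]
  from R have lin: "Vector_Spaces.linear scale (*) lam" "Vector_Spaces.linear scale (*) \<Lambda>"
      "Vector_Spaces.linear scale (*) \<gamma>"
      "bilinear_map scale scale (*) \<theta>" "bilinear_map scale scale (*) f"
    and R': "\<And>p q. lam (mult p q) = lam p * lam q - u * \<theta> p q"
      "\<And>p q. \<Lambda> (mult p q) = \<Lambda> p * \<Lambda> q - u * \<theta> p q"
      "\<And>p. f p p = 0" "\<And>p q. \<gamma> (bracket p q) = 0"
      "\<And>p q. \<gamma> (mult p q) = \<gamma> p * \<Lambda> q + lam p * \<gamma> q"
      "\<And>p q. lam (bracket p q) = - u * f p q" "\<And>p q. \<Lambda> (bracket p q) = - u * f p q"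
    and \<theta>_assoc: "\<And>p q r. \<theta> p (mult q r) - \<theta> (mult p q) r = \<theta> p q * \<Lambda> r - \<theta> q r * lam p"
    and f_jacobi: "\<And>p q r. f p (bracket q r) + f q (bracket r p) + f r (bracket p q)
      + \<gamma> p * f q r + \<gamma> q * f r p + \<gamma> r * f p q = 0"
    and f_leibniz: "\<And>p q r. f (mult p q) r - \<Lambda> q * f p r - lam p * f q r =
      \<gamma> r * \<theta> p q + \<theta> (bracket p r) q + \<theta> p (bracket q r)"
    and comm: "\<And>p. u * \<Lambda> p = u * lam p" "\<And>p. u * \<gamma> p = 0"
    by iprover+
  note linE = lin(1-3)[unfolded Vector_Spaces.linear_iff] lin(4,5)[unfolded bilinear_map_iff]
  have \<theta>_mult: "\<theta> p (mult q r) = \<theta> (mult p q) r + \<theta> p q * \<Lambda> r - \<theta> q r * lam p" for p q r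
    using \<theta>_assoc[of p q r] by (simp add: algebra_simps)
  have f_mult: "f (mult p q) r = \<Lambda> q * f p r + lam p * f q r +
      \<gamma> r * \<theta> p q + \<theta> (bracket p r) q + \<theta> p (bracket q r)" for p q r
    using f_leibniz[of p q r] by (simp add: algebra_simps)
  have cyc: "f p (bracket q r) = - (f q (bracket r p) + f r (bracket p q)
      + \<gamma> p * f q r + \<gamma> q * f r p + \<gamma> r * f p q)" for p q r
    using f_jacobi[of p q r] by (simp add: eq_neg_iff_add_eq_0 algebra_simps)
  have cm: "crossed_mult mult ?S (p, x) (q, y) =
      (mult p q, \<theta> p q + lam p * y + \<Lambda> q * x + u * x * y)" for p q x y
    by (simp add: crossed_mult_def sel)
  have cb: "crossed_bracket bracket ?S (p, x) (q, y) =
      (bracket p q, f p q + \<gamma> p * y - \<gamma> q * x)" for p q x y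
    by (simp add: crossed_bracket_def sel)
  \<comment> \<open>Terms with a factor \<open>u\<close> cancel only via \<open>u \<Lambda> = u \<lambda>\<close> and \<open>u \<gamma> = 0\<close>, which are no use as rewrite
    rules inside monomials; the case split makes them usable.\<close>
  have cases_u: "u = 0 \<or> (\<forall>p. \<Lambda> p = lam p \<and> \<gamma> p = 0)"
    using comm by auto
  have assoc: "\<theta> (mult p q) r + lam (mult p q) * z + \<Lambda> r * (\<theta> p q + lam p * y + \<Lambda> q * x + u * x * y)
        + u * (\<theta> p q + lam p * y + \<Lambda> q * x + u * x * y) * z =
      \<theta> p (mult q r) + lam p * (\<theta> q r + lam q * z + \<Lambda> r * y + u * y * z) + \<Lambda> (mult q r) * x
        + u * x * (\<theta> q r + lam q * z + \<Lambda> r * y + u * y * z)" for p q r x y z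
    using cases_u
  proof
    assume "u = 0"
    then show ?thesis by (simp add: \<theta>_mult R' algebra_simps)
  next
    assume *: "\<forall>p. \<Lambda> p = lam p \<and> \<gamma> p = 0"
    then have "\<Lambda> p = lam p" for p by blast
    then show ?thesis by (simp add: \<theta>_mult R'(1) algebra_simps)
  qed
  have leib: "f (mult p q) r + \<gamma> (mult p q) * z - \<gamma> r * (\<theta> p q + lam p * y + \<Lambda> q * x + u * x * y) =
      \<theta> (bracket p r) q + lam (bracket p r) * y + \<Lambda> q * (f p r + \<gamma> p * z - \<gamma> r * x)
        + u * (f p r + \<gamma> p * z - \<gamma> r * x) * y +
      (\<theta> p (bracket q r) + lam p * (f q r + \<gamma> q * z - \<gamma> r * y) + \<Lambda> (bracket q r) * x
        + u * x * (f q r + \<gamma> q * z - \<gamma> r * y))" for p q r x y z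
    using cases_u
  proof
    assume "u = 0"
    then show ?thesis by (simp add: f_mult R' algebra_simps)
  next
    assume *: "\<forall>p. \<Lambda> p = lam p \<and> \<gamma> p = 0"
    then have "\<Lambda> p = lam p" "\<gamma> p = 0" for p by blast+
    then show ?thesis by (simp add: f_mult R'(6) algebra_simps)
  qed
  have jac: "(f p (bracket q r) + \<gamma> p * (f q r + \<gamma> q * z - \<gamma> r * y) - \<gamma> (bracket q r) * x)
      + (f q (bracket r p) + \<gamma> q * (f r p + \<gamma> r * x - \<gamma> p * z) - \<gamma> (bracket r p) * y)
      + (f r (bracket p q) + \<gamma> r * (f p q + \<gamma> p * y - \<gamma> q * x) - \<gamma> (bracket p q) * z) = 0"
    for p q r x y z
    by (simp add: R'(4) cyc[of p q r] algebra_simps)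
  have pa: "poisson_algebra (module_prod.scale scale (*)) (crossed_mult mult ?S)
      (crossed_bracket bracket ?S)"
    unfolding poisson_algebra_def poisson_algebra_axioms_def
  proof (intro conjI allI)
    show "vector_space (module_prod.scale scale ((*) :: 'k \<Rightarrow> 'k \<Rightarrow> 'k))"
      by (rule vector_space_prod_times)
    show "bilinear_map (module_prod.scale scale (*)) (module_prod.scale scale (*))
        (module_prod.scale scale (*)) (crossed_mult mult ?S)"
      by (simp add: bilinear_map_iff vector_space_prod_times prod_times_scale cm split_paired_all bil linE)
        (simp add: algebra_simps)
    show "bilinear_map (module_prod.scale scale (*)) (module_prod.scale scale (*))
        (module_prod.scale scale (*)) (crossed_bracket bracket ?S)"
      by (simp add: bilinear_map_iff vector_space_prod_times prod_times_scale cb split_paired_all bil linE)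
        (simp add: algebra_simps)
    fix P Q R :: "'p \<times> 'k"
    obtain p x q y r z where eqs: "P = (p, x)" "Q = (q, y)" "R = (r, z)"
      by (metis surj_pair)
    show "crossed_mult mult ?S (crossed_mult mult ?S P Q) R =
        crossed_mult mult ?S P (crossed_mult mult ?S Q R)"
      unfolding eqs cm by (simp only: mult_assoc assoc)
    show "crossed_bracket bracket ?S P P = 0"
      by (simp add: eqs cb bracket_self R'(3) zero_prod_def)
    show "crossed_bracket bracket ?S P (crossed_bracket bracket ?S Q R) +
        crossed_bracket bracket ?S Q (crossed_bracket bracket ?S R P) +
        crossed_bracket bracket ?S R (crossed_bracket bracket ?S P Q) = 0"
      unfolding eqs cb by (simp only: add_Pair jacobi jac zero_prod_def)
    show "crossed_bracket bracket ?S (crossed_mult mult ?S P Q) R =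
        crossed_mult mult ?S (crossed_bracket bracket ?S P R) Q +
        crossed_mult mult ?S P (crossed_bracket bracket ?S Q R)"
      unfolding eqs cb cm by (simp only: add_Pair leibniz leib)
  qed
  have z: "bilinear_map (*) (*) (*) (\<lambda>_ _. 0 :: 'k)" "bilinear_map (*) (*) (*) (\<lambda>x y. u * x * y)"
    by (auto simp: bilinear_map_iff vector_space_times algebra_simps)
  show "?S \<in> crossed_systems scale mult bracket (*)"
    using pa lin z by (auto simp: crossed_systems_def sel bilinear_scalar_iff)
qed

text \<open>
  Since the bracket on \<open>k\<close> vanishes, \<open>\<gamma>\<close> is an invariant, whereas \<open>\<lambda>\<close> and \<open>\<Lambda>\<close> are shifted by \<open>u r\<close>; for
  \<open>u = 0\<close> they are invariants too, and for \<open>u \<noteq> 0\<close> they determine \<open>r\<close>.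
\<close>
lemma scalar_system_cohomologous_iff:
  fixes lam \<Lambda> \<gamma> lam' \<Lambda>' \<gamma>' :: "'p \<Rightarrow> 'k" and \<theta> f \<theta>' f' :: "'p \<Rightarrow> 'p \<Rightarrow> 'k" and u u' :: 'k
  assumes "scalar_system lam \<Lambda> \<theta> u \<gamma> f \<in> crossed_systems scale mult bracket (*)"
    and "scalar_system lam' \<Lambda>' \<theta>' u' \<gamma>' f' \<in> crossed_systems scale mult bracket (*)"
  shows "(scalar_system lam \<Lambda> \<theta> u \<gamma> f, scalar_system lam' \<Lambda>' \<theta>' u' \<gamma>' f')
      \<in> cohomologous scale mult bracket (*) \<longleftrightarrow>
    u = u' \<and> \<gamma> = \<gamma>' \<and>
    (\<exists>r. Vector_Spaces.linear scale (*) r \<and>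
      (\<forall>p. lam p = lam' p + u * r p) \<and> (\<forall>p. \<Lambda> p = \<Lambda>' p + u * r p) \<and>
      (\<forall>p q. \<theta> p q = \<theta>' p q + lam' p * r q + \<Lambda>' q * r p - r (mult p q) + u * r p * r q) \<and>
      (\<forall>p q. f p q = f' p q + \<gamma>' p * r q - \<gamma>' q * r p - r (bracket p q)))"
proof -
  have cancel: "(\<forall>x. a * x = b * x + c * x) \<longleftrightarrow> a = b + c" "(\<forall>x. a * x = b * x) \<longleftrightarrow> a = b"
    for a b c :: 'k
    by (auto simp: algebra_simps dest: spec[of _ 1])
  have multV: "(\<lambda>x y. u * x * y) = (\<lambda>x y. u' * x * y) \<longleftrightarrow> u = u'"
    by (metis mult_1_right)
  have lact: "(\<forall>p x. lam p * x = lam' p * x + u * r p * x) \<longleftrightarrow> (\<forall>p. lam p = lam' p + u * r p)" for r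
    by (simp only: cancel)
  have ract: "(\<forall>x p. \<Lambda> p * x = \<Lambda>' p * x + u * x * r p) \<longleftrightarrow> (\<forall>p. \<Lambda> p = \<Lambda>' p + u * r p)" for r
  proof -
    have "u * x * r p = u * r p * x" for x p by (simp only: ac_simps)
    then show ?thesis by (subst all_comm) (simp only: cancel)
  qed
  have lie_act: "(\<forall>p x. \<gamma> p * x = \<gamma>' p * x) \<longleftrightarrow> \<gamma> = \<gamma>'"
    by (simp only: cancel fun_eq_iff)
  show ?thesis
    using assms unfolding cohomologous_def scalar_system_def
    by (simp only: mem_Collect_eq prod.case crossed_data.simps add_0_right multV lact ract lie_act)
      blast
qed

end

section \<open>Co-flag data as crossed systems\<close>

context poisson_algebra
begin

definition abelian_system :: "('p, 'k) abelian_data \<Rightarrow> ('p, 'k) crossed_data" where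
  "abelian_system D = scalar_system (af_lambda D) (af_Lambda D) (af_theta D) 0 (af_gamma D) (af_f D)"

text \<open>
  For \<open>u \<noteq> 0\<close> the product of \<open>k\<close> leaves no freedom in the Lie part: the Leibniz rule for
  \<open>(p, 0), (0, 1), (q, 0)\<close> reads \<open>\<lambda>[p, q] + u f(p, q) = 0\<close>.
\<close>
definition nonabelian_system :: "('p, 'k) nonabelian_data \<Rightarrow> ('p, 'k) crossed_data" where
  "nonabelian_system D = scalar_system (nf_lambda D) (nf_lambda D) (nf_theta D) (nf_u D) (\<lambda>_. 0)
     (\<lambda>p q. - nf_lambda D (bracket p q) / nf_u D)"

lemma abelian_system_crossed_iff:
  "abelian_system D \<in> crossed_systems scale mult bracket (*) \<longleftrightarrow> D \<in> AF scale mult bracket"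
  unfolding abelian_system_def scalar_system_crossed_iff AF_def abelian_co_flag_datum_def
  by (simp add: all_conj_distrib conj_ac)

text \<open>
  The equations for the Lie cocycle \<open>- \<lambda>[p, q] / u\<close> are obtained by applying \<open>\<lambda>\<close> to the Jacobi and
  Leibniz identities of \<open>P\<close>; in the second, \<open>\<lambda>\<close> of a product produces the \<open>\<theta>\<close>-terms.
\<close>
lemma nonabelian_system_crossed:
  assumes "D \<in> NF scale mult"
  shows "nonabelian_system D \<in> crossed_systems scale mult bracket (*)"
proof -
  define l \<theta> u where "l = nf_lambda D" and "\<theta> = nf_theta D" and "u = nf_u D"
  have D: "u \<noteq> 0" "Vector_Spaces.linear scale (*) l" "bilinear_map scale scale (*) \<theta>"
      "\<And>p q. l (mult p q) = l p * l q - u * \<theta> p q"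
      "\<And>p q r. \<theta> p (mult q r) - \<theta> (mult p q) r = \<theta> p q * l r - \<theta> q r * l p"
    using assms by (auto simp: NF_def nonabelian_co_flag_datum_def l_def \<theta>_def u_def)
  have add: "l (p + q) = l p + l q" and scl: "l (scale c p) = c * l p" for p q c
    using D(2) by (auto simp: Vector_Spaces.linear_iff)
  have l0: "l 0 = 0" using add[of 0 0] by (metis add_cancel_right_right add_0)
  have lin0: "Vector_Spaces.linear scale (*) (\<lambda>_. 0 :: 'k)"
    by (simp add: Vector_Spaces.linear_iff vector_space_axioms vector_space_times)
  have f: "bilinear_map scale scale (*) (\<lambda>p q. - l (bracket p q) / u)"
    using bilinear_bracket
    by (auto simp: bilinear_map_iff vector_space_times add scl field_simps D(1))
  have jac: "l (bracket p (bracket q r)) + l (bracket q (bracket r p)) + l (bracket r (bracket p q)) = 0"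
    for p q r using jacobi[of p q r] by (metis add l0)
  show ?thesis
    unfolding nonabelian_system_def scalar_system_crossed_iff
      l_def[symmetric] \<theta>_def[symmetric] u_def[symmetric]
  proof (intro conjI allI)
    fix p q r
    have "- a / u + - b / u + - c / u + 0 * a' + 0 * b' + 0 * c' = - (a + b + c) / u"
      for a b c a' b' c' :: 'k by (simp add: add_divide_distrib diff_divide_distrib)
    then show "- l (bracket p (bracket q r)) / u + - l (bracket q (bracket r p)) / u +
       - l (bracket r (bracket p q)) / u + 0 * (- l (bracket q r) / u) +
       0 * (- l (bracket r p) / u) + 0 * (- l (bracket p q) / u) = 0"
      by (simp only: jac) simp
    show "- l (bracket (mult p q) r) / u - l q * (- l (bracket p r) / u) - l p * (- l (bracket q r) / u) =
       0 * \<theta> p q + \<theta> (bracket p r) q + \<theta> p (bracket q r)"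
      using D(1) by (simp add: leibniz add D(4) field_simps)
  qed (use D lin0 f in \<open>simp_all add: bracket_self l0\<close>)
qed

lemma abelian_system_cohomologous_iff:
  assumes "D \<in> AF scale mult bracket" "D' \<in> AF scale mult bracket"
  shows "(abelian_system D, abelian_system D') \<in> cohomologous scale mult bracket (*) \<longleftrightarrow>
    (D, D') \<in> AF_rel scale mult bracket"
  using assms[folded abelian_system_crossed_iff] assms
  unfolding abelian_system_def
  by (subst scalar_system_cohomologous_iff)
    (auto simp: AF_rel_def fun_eq_iff mult.commute)

text \<open>
  Cohomology also asks that the Lie cocycles differ by \<open>r[p, q]\<close>.  This is implied by
  \<open>\<lambda> = \<lambda>' + u r\<close> evaluated on brackets and divided by \<open>- u\<close>.
\<close>
lemma nonabelian_system_cohomologous_iff: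
  assumes "D \<in> NF scale mult" "D' \<in> NF scale mult"
  shows "(nonabelian_system D, nonabelian_system D') \<in> cohomologous scale mult bracket (*) \<longleftrightarrow>
    (D, D') \<in> NF_rel scale mult"
proof -
  have u: "nf_u D \<noteq> 0" using assms by (simp add: NF_def nonabelian_co_flag_datum_def)
  show ?thesis
    using nonabelian_system_crossed[OF assms(1)] nonabelian_system_crossed[OF assms(2)] assms u
    unfolding nonabelian_system_def
    by (subst scalar_system_cohomologous_iff)
      (auto simp: NF_rel_def field_simps intro!: ex_cong1)
qed

lemma abelian_nonabelian_not_cohomologous:
  assumes "D' \<in> NF scale mult"
  shows "(abelian_system D, nonabelian_system D') \<notin> cohomologous scale mult bracket (*)"
proof
  assume "(abelian_system D, nonabelian_system D') \<in> cohomologous scale mult bracket (*)"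
  then have "multV (abelian_system D) 1 1 = multV (nonabelian_system D') 1 1"
    by (simp add: cohomologous_def)
  then show False
    using assms by (simp add: abelian_system_def nonabelian_system_def scalar_system_def NF_def
        nonabelian_co_flag_datum_def)
qed

lemma crossed_systems_cover:
  "abelian_system ` AF scale mult bracket \<union> nonabelian_system ` NF scale mult =
    crossed_systems scale mult bracket (*)" (is "?A \<union> ?N = ?C")
proof
  show "?A \<union> ?N \<subseteq> ?C"
    by (auto simp: abelian_system_crossed_iff nonabelian_system_crossed)
  show "?C \<subseteq> ?A \<union> ?N"
  proof
    fix S :: "('p, 'k) crossed_data"
    assume C: "S \<in> ?C"
    obtain l \<Lambda> \<theta> u \<gamma> f where S: "S = scalar_system l \<Lambda> \<theta> u \<gamma> f"
      using crossed_system_is_scalar[OF C] by blast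
    note ax = C[unfolded S scalar_system_crossed_iff]
    show "S \<in> ?A \<union> ?N"
    proof (cases "u = 0")
      case True
      define D where "D = \<lparr>af_lambda = l, af_Lambda = \<Lambda>, af_theta = \<theta>, af_gamma = \<gamma>, af_f = f\<rparr>"
      have "S = abelian_system D" by (simp add: S D_def abelian_system_def True)
      then show ?thesis using C abelian_system_crossed_iff by blast
    next
      case False
      define D where "D = \<lparr>nf_lambda = l, nf_theta = \<theta>, nf_u = u\<rparr>"
      have "\<Lambda> = l" "\<gamma> = (\<lambda>_. 0)" "f = (\<lambda>p q. - l (bracket p q) / u)"
        using ax False by (auto simp: fun_eq_iff)
      then have "S = nonabelian_system D" by (simp add: S D_def nonabelian_system_def)
      moreover have "D \<in> NF scale mult"
        using ax False \<open>\<Lambda> = l\<close> by (simp add: D_def NF_def nonabelian_co_flag_datum_def)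
      ultimately show ?thesis by blast
    qed
  qed
qed

end

theorem theorem3p6:
  fixes sP :: "'k::field \<Rightarrow> 'p::ab_group_add \<Rightarrow> 'p"
    and mult bracket :: "'p \<Rightarrow> 'p \<Rightarrow> 'p"
  assumes "poisson_algebra sP mult bracket"
  shows "equiv (AF sP mult bracket) (AF_rel sP mult bracket) \<and>
    equiv (NF sP mult) (NF_rel sP mult) \<and>
    (\<exists>\<Phi>. bij_betw \<Phi>
       (GPH2 sP mult bracket ((*) :: 'k \<Rightarrow> 'k \<Rightarrow> 'k))
       ((AF sP mult bracket // AF_rel sP mult bracket) <+> (NF sP mult // NF_rel sP mult)))"
proof -
  interpret poisson_algebra sP mult bracket by fact
  have C: "equiv (crossed_systems sP mult bracket (*)) (cohomologous sP mult bracket ((*) :: 'k \<Rightarrow> 'k \<Rightarrow> 'k))"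
    by (rule equiv_cohomologous[OF vector_space_axioms vector_space_times])
  have A: "equiv (AF sP mult bracket) (AF_rel sP mult bracket)"
    using crossed_systems_cover
    by (intro equiv_pullback[OF C, of abelian_system])
      (auto simp: abelian_system_cohomologous_iff AF_rel_def)
  have N: "equiv (NF sP mult) (NF_rel sP mult)"
    using crossed_systems_cover
    by (intro equiv_pullback[OF C, of nonabelian_system])
      (auto simp: nonabelian_system_cohomologous_iff NF_rel_def)
  show ?thesis
    unfolding GPH2_def
    using A N bij_betw_quotient_sum[OF C crossed_systems_cover A N
        abelian_system_cohomologous_iff nonabelian_system_cohomologous_iff
        abelian_nonabelian_not_cohomologous]
    by blast
qed

end
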